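(* Let $F=(f_1,\dots,f_n):\mathbb{R}^n\to\mathbb{R}^n$ be an everywhere defined real rational map with nowhere vanishing Jacobian determinant. If $F$ has an inverse, then the identity is the only automorphism of the field $\mathbb{R}(X)=\mathbb{R}(x_1,\dots,x_n)$ that preserves (fixes) every element of $\mathbb{R}(F)=\mathbb{R}(f_1,\dots,f_n)$.
   Context: An everywhere defined real rational map is one each of whose components can be written as a fraction of real polynomials with denominator vanishing nowhere on $\mathbb{R}^n$. "$F$ has an inverse" means that $F$ is bijective as a map $\mathbb{R}^n\to\mathbb{R}^n$ (the inverse, which is then real analytic, is not required to be rational). *)

theory Defs
  imports
    "HOL-Analysis.Analysis"
    "HOL-Library.Poly_Mapping"
    "HOL-Algebra.Generated_Fields"
    "HOL-Algebra.QuotRing"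
    "HOL-Algebra.Algebraic_Closure_Type"
begin

text \<open>
  The variables are indexed by a finite type \<open>'n\<close> with \<open>n = CARD('n)\<close>. A polynomial is
  a finitely supported map from exponent vectors to coefficients. A linear order on \<open>'n\<close> is
  needed only because the library's integral domain instance for \<^type>\<open>poly_mapping\<close>
  requires ordered exponents.
\<close>

type_synonym 'n real_mpoly = "('n \<Rightarrow>\<^sub>0 nat) \<Rightarrow>\<^sub>0 real"

type_synonym 'n real_ratfun = "'n real_mpoly fract"

definition mpoly_eval :: "'n real_mpoly \<Rightarrow> real ^ 'n::finite \<Rightarrow> real"
  where "mpoly_eval p x =
    (\<Sum>m\<in>Poly_Mapping.keys p. Poly_Mapping.lookup p m * (\<Prod>i\<in>UNIV. (x $ i) ^ Poly_Mapping.lookup m i))"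

definition ratfun_const :: "real \<Rightarrow> 'n::{finite,linorder} real_ratfun"
  where "ratfun_const c = Fract (Poly_Mapping.single 0 c) 1"

definition ratfun_field :: "'n::{finite,linorder} real_ratfun ring"
  where "ratfun_field = ring_of_type_algebra"

text \<open>
  The representing element \<open>r\<close> is determined by the function \<open>g\<close>, because a real
  polynomial that vanishes at every point is the zero polynomial. The fraction \<open>p / q\<close> is
  not required to be in lowest terms.
\<close>

definition represents ::
    "'n::{finite,linorder} real_ratfun \<Rightarrow> (real ^ 'n::{finite,linorder} \<Rightarrow> real) \<Rightarrow> bool"
  where "represents r g \<longleftrightarrow>
    (\<exists>p q. r = Fract p q \<and> (\<forall>x. mpoly_eval q x \<noteq> 0) \<and> (\<forall>x. g x = mpoly_eval p x / mpoly_eval q x))"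

definition everywhere_defined_rational_map ::
    "(real ^ 'n::{finite,linorder} \<Rightarrow> real ^ 'n::{finite,linorder}) \<Rightarrow> bool"
  where "everywhere_defined_rational_map F \<longleftrightarrow> (\<forall>i. \<exists>r. represents r (\<lambda>x. F x $ i))"

text \<open>The field \<open>\<real>(F)\<close>, as a subfield of \<open>\<real>(X)\<close>:\<close>

definition component_field ::
    "(real ^ 'n::{finite,linorder} \<Rightarrow> real ^ 'n::{finite,linorder}) \<Rightarrow> 'n real_ratfun set"
  where "component_field F =
    generate_field ratfun_field (range ratfun_const \<union> {r. \<exists>i. represents r (\<lambda>x. F x $ i)})"

end

theory Submission
  imports Defs
begin

text \<open>
  Let \<open>\<phi>\<close> be an automorphism fixing \<open>\<real>(F)\<close> and put \<open>g\<^sub>i = \<phi>(x\<^sub>i)\<close>. As \<open>\<phi>\<close> fixes the constants,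
  \<open>\<phi>(r) = r \<circ> g\<close>, so \<open>\<phi>(f\<^sub>j) = f\<^sub>j\<close> says that \<open>F(g(x)) = F(x)\<close> at every point \<open>x\<close> where the
  denominators of the \<open>g\<^sub>i\<close> do not vanish. Injectivity of \<open>F\<close> gives \<open>g(x) = x\<close> there, hence
  \<open>g\<^sub>i = x\<^sub>i\<close> as rational functions, and \<open>\<phi>\<close> is the identity.
\<close>

section \<open>Evaluation of polynomials\<close>

definition monom_eval :: "('n::finite \<Rightarrow>\<^sub>0 nat) \<Rightarrow> real ^ 'n \<Rightarrow> real"
  where "monom_eval m x = (\<Prod>i\<in>UNIV. (x $ i) ^ Poly_Mapping.lookup m i)"

lemma monom_eval_0 [simp]: "monom_eval 0 x = 1"
  by (simp add: monom_eval_def)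

lemma monom_eval_add: "monom_eval (m + n) x = monom_eval m x * monom_eval n x"
  by (simp add: monom_eval_def lookup_add power_add prod.distrib)

lemma monom_eval_1 [simp]: "monom_eval m 1 = 1"
  by (simp add: monom_eval_def one_vec_def)

lemma monom_eval_times: "monom_eval m (x * y) = monom_eval m x * monom_eval m y"
  by (simp add: monom_eval_def times_vec_def power_mult_distrib prod.distrib)

lemma monom_eval_single [simp]: "monom_eval (Poly_Mapping.single i k) x = (x $ i) ^ k"
proof -
  have "monom_eval (Poly_Mapping.single i k) x = (\<Prod>j\<in>UNIV. if j = i then (x $ i) ^ k else 1)"
    unfolding monom_eval_def by (rule prod.cong) (auto simp: lookup_single when_def)
  then show ?thesis by simp
qed

text \<open>Exponent vectors that differ at \<open>i\<close> are told apart by the point with entry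
  2 at \<open>i\<close> and 1 elsewhere, because powers of 2 determine their exponent.\<close>

lemma monom_eval_separates:
  assumes "m \<noteq> n"
  obtains y where "monom_eval m y \<noteq> monom_eval n y"
proof -
  obtain i where i: "Poly_Mapping.lookup m i \<noteq> Poly_Mapping.lookup n i"
    using assms by (meson poly_mapping_eqI)
  define y :: "real ^ 'a" where "y = (\<chi> j. if j = i then 2 else 1)"
  have "monom_eval k y = 2 ^ Poly_Mapping.lookup k i" for k
  proof -
    have "monom_eval k y = (\<Prod>j\<in>UNIV. if j = i then 2 ^ Poly_Mapping.lookup k i else 1)"
      unfolding monom_eval_def by (rule prod.cong) (auto simp: y_def)
    then show ?thesis by simp
  qed
  with i have "monom_eval m y \<noteq> monom_eval n y"
    by simp
  then show ?thesis by (rule that)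
qed

text \<open>Dedekind's argument: the monomials are distinct characters of the multiplicative monoid of
  the ring \<open>\<real>\<^sup>n\<close>.\<close>

lemma monom_eval_independent:
  assumes "finite A" and "\<And>x. (\<Sum>m\<in>A. c m * monom_eval m x) = 0" and "k \<in> A"
  shows "c k = 0"
  using assms
proof (induction A arbitrary: c k rule: finite_induct)
  case empty
  then show ?case by simp
next
  case (insert a A)
  \<comment> \<open>Taking the relation at \<open>x * y\<close> and subtracting
    \<open>monom_eval a y\<close> times the relation at \<open>x\<close> cancels the term of
    \<open>a\<close>. What remains is a relation over \<open>A\<close>, with new coefficients, to
    which the induction hypothesis applies.\<close>
  have *: "c m * (monom_eval m y - monom_eval a y) = 0" if "m \<in> A" for m y
  proof (rule insert.IH[OF _ that])
    fix x
    have 1: "c a * monom_eval a z + (\<Sum>m\<in>A. c m * monom_eval m z) = 0" for z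
      using insert.prems(1)[of z] insert.hyps by simp
    have "(\<Sum>m\<in>A. c m * (monom_eval m y - monom_eval a y) * monom_eval m x) =
        (\<Sum>m\<in>A. c m * monom_eval m (x * y)) - monom_eval a y * (\<Sum>m\<in>A. c m * monom_eval m x)"
      by (simp add: monom_eval_times sum_distrib_left sum_subtractf [symmetric] algebra_simps)
    also have "\<dots> = 0"
    proof -
      have S: "(\<Sum>m\<in>A. c m * monom_eval m z) = - (c a * monom_eval a z)" for z
        using 1[of z] by linarith
      show ?thesis
        unfolding S by (simp add: monom_eval_times)
    qed
    finally show "(\<Sum>m\<in>A. c m * (monom_eval m y - monom_eval a y) * monom_eval m x) = 0" .
  qed
  have A: "c m = 0" if "m \<in> A" for m
  proof -
    have "m \<noteq> a" using that insert.hyps by auto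
    then obtain y where "monom_eval m y \<noteq> monom_eval a y"
      by (rule monom_eval_separates)
    then show ?thesis using *[OF that, of y] by simp
  qed
  \<comment> \<open>At the all-ones vector every monomial is 1, so the original relation reduces to
    its only surviving coefficient.\<close>
  then have "c a = 0"
    using insert.prems(1)[of 1] insert.hyps by simp
  with A insert.prems(2) show ?case by auto
qed

text \<open>Exponents outside the support contribute coefficient 0. This lets several polynomials be
  summed over one common index set, and covers \<open>single m c\<close> when
  \<open>c = 0\<close>.\<close>

lemma mpoly_eval_superset:
  assumes "finite A" "Poly_Mapping.keys p \<subseteq> A"
  shows "mpoly_eval p x = (\<Sum>m\<in>A. Poly_Mapping.lookup p m * monom_eval m x)"
  unfolding mpoly_eval_def monom_eval_def using assms
  by (intro sum.mono_neutral_left) (auto simp: in_keys_iff)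

lemma mpoly_eval_single [simp]: "mpoly_eval (Poly_Mapping.single m c) x = c * monom_eval m x"
  by (subst mpoly_eval_superset[of "{m}"]) auto

lemma mpoly_eval_0 [simp]: "mpoly_eval 0 x = 0"
  by (simp add: mpoly_eval_def)

lemma mpoly_eval_1 [simp]: "mpoly_eval 1 x = 1"
  by (simp flip: single_one)

lemma mpoly_eval_add [simp]: "mpoly_eval (p + q) x = mpoly_eval p x + mpoly_eval q x"
proof -
  have "finite (Poly_Mapping.keys p \<union> Poly_Mapping.keys q)" by simp
  then show ?thesis
    using mpoly_eval_superset[of "Poly_Mapping.keys p \<union> Poly_Mapping.keys q"] keys_add[of p q]
    by (simp add: lookup_add distrib_right sum.distrib)
qed

lemma mpoly_eval_uminus [simp]: "mpoly_eval (- p) x = - mpoly_eval p x"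
  using mpoly_eval_add[of p "- p" x] by simp

lemma mpoly_eval_diff [simp]: "mpoly_eval (p - q) x = mpoly_eval p x - mpoly_eval q x"
  using mpoly_eval_add[of p "- q" x] by simp

lemma mpoly_eval_sum [simp]: "mpoly_eval (\<Sum>i\<in>A. p i) x = (\<Sum>i\<in>A. mpoly_eval (p i) x)"
  by (induction A rule: infinite_finite_induct) auto

lemma mpoly_eq_sum_single:
  "p = (\<Sum>m\<in>Poly_Mapping.keys p. Poly_Mapping.single m (Poly_Mapping.lookup p m))"
  by (rule poly_mapping_eqI)
    (simp add: lookup_sum lookup_single when_def in_keys_iff sum.delta)

lemma mpoly_eval_mult [simp]: "mpoly_eval (p * q) x = mpoly_eval p x * mpoly_eval q x"
proof -
  have "p * q = (\<Sum>m\<in>Poly_Mapping.keys p. \<Sum>n\<in>Poly_Mapping.keys q.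
      Poly_Mapping.single (m + n) (Poly_Mapping.lookup p m * Poly_Mapping.lookup q n))"
    by (subst mpoly_eq_sum_single[of p], subst mpoly_eq_sum_single[of q])
      (simp add: sum_product mult_single)
  then have "mpoly_eval (p * q) x = (\<Sum>m\<in>Poly_Mapping.keys p. \<Sum>n\<in>Poly_Mapping.keys q.
      (Poly_Mapping.lookup p m * monom_eval m x) * (Poly_Mapping.lookup q n * monom_eval n x))"
    by (simp add: monom_eval_add mult_ac)
  then show ?thesis
    by (simp add: mpoly_eval_def sum_product flip: monom_eval_def)
qed

lemma mpoly_eval_power [simp]: "mpoly_eval (p ^ k) x = mpoly_eval p x ^ k"
  by (induction k) auto

lemma mpoly_eval_prod [simp]: "mpoly_eval (\<Prod>i\<in>A. p i) x = (\<Prod>i\<in>A. mpoly_eval (p i) x)"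
  by (induction A rule: infinite_finite_induct) auto

section \<open>Polynomials are determined by their values\<close>

lemma mpoly_eval_eq_0_imp:
  assumes "\<And>x. mpoly_eval p x = 0"
  shows "p = 0"
proof (rule poly_mapping_eqI)
  fix k
  show "Poly_Mapping.lookup p k = Poly_Mapping.lookup 0 k"
    using monom_eval_independent[of "Poly_Mapping.keys p" "Poly_Mapping.lookup p" k] assms
    by (cases "k \<in> Poly_Mapping.keys p") (auto simp: mpoly_eval_def monom_eval_def in_keys_iff)
qed

lemma mpoly_eqI:
  assumes "\<And>x. mpoly_eval p x = mpoly_eval q x"
  shows "p = q"
  using mpoly_eval_eq_0_imp[of "p - q"] assms by simp

text \<open>The product \<open>d * (p - q)\<close> vanishes at every point, hence is the zero
  polynomial, and the polynomial ring is an integral domain. This replaces a density argument for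
  the set where \<open>d\<close> is nonzero.\<close>

lemma mpoly_eqI_generic:
  fixes p q d :: "'n::{finite,linorder} real_mpoly"
  assumes "d \<noteq> 0" and "\<And>x. mpoly_eval d x \<noteq> 0 \<Longrightarrow> mpoly_eval p x = mpoly_eval q x"
  shows "p = q"
proof -
  have "d * (p - q) = 0"
    using assms(2) by (intro mpoly_eval_eq_0_imp) auto
  with assms(1) show ?thesis by simp
qed

section \<open>Values of rational functions\<close>

text \<open>A relation instead of a function, since a rational function may have no value at
  \<open>x\<close>. Any representation whose denominator is nonzero at \<open>x\<close> may supply
  the value.\<close>

definition takes_value :: "'n::{finite,linorder} real_ratfun \<Rightarrow> real ^ 'n::{finite,linorder} \<Rightarrow> real \<Rightarrow> bool"
  where "takes_value r x v \<longleftrightarrow>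
    (\<exists>p q. r = Fract p q \<and> mpoly_eval q x \<noteq> 0 \<and> v = mpoly_eval p x / mpoly_eval q x)"

lemma takes_valueI:
  "mpoly_eval q x \<noteq> 0 \<Longrightarrow> takes_value (Fract p q) x (mpoly_eval p x / mpoly_eval q x)"
  unfolding takes_value_def by blast

lemma takes_value_Fract_1: "takes_value (Fract p 1) x (mpoly_eval p x)"
  using takes_valueI[of 1 x p] by simp

lemma takes_value_represents: "represents r g \<Longrightarrow> takes_value r x (g x)"
  unfolding represents_def takes_value_def by blast

text \<open>Two representations of \<open>r\<close> satisfy \<open>p * q' = p' * q\<close> as
  polynomials; evaluating this at \<open>x\<close> and dividing by the nonzero denominators equates
  the values.\<close>

lemma takes_value_unique:
  assumes "takes_value r x v" "takes_value r x w"
  shows "v = w"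
proof -
  obtain p q where 1: "r = Fract p q" "mpoly_eval q x \<noteq> 0" "v = mpoly_eval p x / mpoly_eval q x"
    using assms(1) unfolding takes_value_def by blast
  obtain p' q' where 2: "r = Fract p' q'" "mpoly_eval q' x \<noteq> 0"
      "w = mpoly_eval p' x / mpoly_eval q' x"
    using assms(2) unfolding takes_value_def by blast
  have "q \<noteq> 0" "q' \<noteq> 0" using 1 2 by auto
  then have "p * q' = p' * q" using 1 2 by (simp add: eq_fract)
  then have "mpoly_eval p x * mpoly_eval q' x = mpoly_eval p' x * mpoly_eval q x"
    by (metis mpoly_eval_mult)
  then show ?thesis
    unfolding 1(3) 2(3) using 1(2) 2(2) by (simp add: frac_eq_eq)
qed

lemma takes_value_0: "takes_value 0 x 0"
  using takes_value_Fract_1[of 0 x] by (simp add: Zero_fract_def)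

lemma takes_value_1: "takes_value 1 x 1"
  using takes_value_Fract_1[of 1 x] by (simp add: One_fract_def)

lemma takes_value_const: "takes_value (ratfun_const c) x c"
  using takes_value_Fract_1[of "Poly_Mapping.single 0 c" x] by (simp add: ratfun_const_def)

lemma takes_value_add:
  assumes "takes_value r x v" "takes_value s x w"
  shows "takes_value (r + s) x (v + w)"
proof -
  obtain p q where 1: "r = Fract p q" "mpoly_eval q x \<noteq> 0" "v = mpoly_eval p x / mpoly_eval q x"
    using assms(1) unfolding takes_value_def by blast
  obtain p' q' where 2: "s = Fract p' q'" "mpoly_eval q' x \<noteq> 0"
      "w = mpoly_eval p' x / mpoly_eval q' x"
    using assms(2) unfolding takes_value_def by blast
  have "q \<noteq> 0" "q' \<noteq> 0" using 1 2 by auto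
  then show ?thesis
    using 1 2 takes_valueI[of "q * q'" x "p * q' + p' * q"] by (simp add: add_frac_eq)
qed

lemma takes_value_mult:
  assumes "takes_value r x v" "takes_value s x w"
  shows "takes_value (r * s) x (v * w)"
proof -
  obtain p q where 1: "r = Fract p q" "mpoly_eval q x \<noteq> 0" "v = mpoly_eval p x / mpoly_eval q x"
    using assms(1) unfolding takes_value_def by blast
  obtain p' q' where 2: "s = Fract p' q'" "mpoly_eval q' x \<noteq> 0"
      "w = mpoly_eval p' x / mpoly_eval q' x"
    using assms(2) unfolding takes_value_def by blast
  show ?thesis
    using 1 2 takes_valueI[of "q * q'" x "p * p'"] by simp
qed

lemma takes_value_inverse:
  assumes "takes_value r x v" "v \<noteq> 0"
  shows "takes_value (inverse r) x (inverse v)"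
proof -
  obtain p q where 1: "r = Fract p q" "mpoly_eval q x \<noteq> 0" "v = mpoly_eval p x / mpoly_eval q x"
    using assms(1) unfolding takes_value_def by blast
  then show ?thesis using assms(2) takes_valueI[of p x q] by simp
qed

lemma takes_value_power: "takes_value r x v \<Longrightarrow> takes_value (r ^ k) x (v ^ k)"
  by (induction k) (auto intro: takes_value_1 takes_value_mult)

lemma takes_value_sum:
  "(\<And>i. i \<in> A \<Longrightarrow> takes_value (r i) x (v i)) \<Longrightarrow> takes_value (\<Sum>i\<in>A. r i) x (\<Sum>i\<in>A. v i)"
  by (induction A rule: infinite_finite_induct) (auto intro: takes_value_0 takes_value_add)

lemma takes_value_prod:
  "(\<And>i. i \<in> A \<Longrightarrow> takes_value (r i) x (v i)) \<Longrightarrow> takes_value (\<Prod>i\<in>A. r i) x (\<Prod>i\<in>A. v i)"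
  by (induction A rule: infinite_finite_induct) (auto intro: takes_value_1 takes_value_mult)

section \<open>Endomorphisms of the field of rational functions\<close>

definition mpoly_var :: "'n \<Rightarrow> 'n real_mpoly"
  where "mpoly_var i = Poly_Mapping.single (Poly_Mapping.single i 1) 1"

lemma mpoly_eval_var [simp]: "mpoly_eval (mpoly_var i) x = x $ i"
  by (simp add: mpoly_var_def)

lemma Fract_add_1: "Fract (p + q) 1 = Fract p 1 + Fract q 1"
  by simp

lemma Fract_mult_1: "Fract (p * q) 1 = Fract p 1 * Fract q 1"
  by simp

lemma Fract_sum: "Fract (\<Sum>i\<in>A. p i) 1 = (\<Sum>i\<in>A. Fract (p i) 1)"
  by (induction A rule: infinite_finite_induct)
    (simp_all add: Fract_add_1 flip: Zero_fract_def del: add_fract)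

lemma Fract_power: "Fract (p ^ k) 1 = Fract p 1 ^ k"
  by (induction k) (simp_all add: Fract_mult_1 flip: One_fract_def del: mult_fract)

lemma Fract_prod: "Fract (\<Prod>i\<in>A. p i) 1 = (\<Prod>i\<in>A. Fract (p i) 1)"
  by (induction A rule: infinite_finite_induct)
    (simp_all add: Fract_mult_1 flip: One_fract_def del: mult_fract)

text \<open>Both sides agree as polynomial functions. The right side uses only constants, variables
  and ring operations, so a homomorphism can be pushed through it.\<close>

lemma Fract_mpoly_expand:
  fixes p :: "'n::{finite,linorder} real_mpoly"
  shows "Fract p 1 = (\<Sum>m\<in>Poly_Mapping.keys p. ratfun_const (Poly_Mapping.lookup p m) *
    (\<Prod>i\<in>UNIV. Fract (mpoly_var i) 1 ^ Poly_Mapping.lookup m i))"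
proof -
  have "p = (\<Sum>m\<in>Poly_Mapping.keys p. Poly_Mapping.single 0 (Poly_Mapping.lookup p m) *
      (\<Prod>i\<in>UNIV. mpoly_var i ^ Poly_Mapping.lookup m i))" (is "p = ?q")
    by (rule mpoly_eqI, simp) (simp add: mpoly_eval_def)
  then have "Fract p 1 = Fract ?q 1" by simp
  also have "\<dots> = (\<Sum>m\<in>Poly_Mapping.keys p. ratfun_const (Poly_Mapping.lookup p m) *
      (\<Prod>i\<in>UNIV. Fract (mpoly_var i) 1 ^ Poly_Mapping.lookup m i))"
    by (simp add: Fract_sum ratfun_const_def flip: Fract_prod Fract_power)
  finally show ?thesis .
qed

text \<open>States in terms of the operations of the type what is extracted from an automorphism
  over R(F), so that the substitution arguments can avoid the record
  \<open>ratfun_field\<close>.\<close>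

locale ratfun_endomorphism =
  fixes \<phi> :: "'n::{finite,linorder} real_ratfun \<Rightarrow> 'n real_ratfun"
  assumes hom_add: "\<phi> (r + s) = \<phi> r + \<phi> s"
    and hom_mult: "\<phi> (r * s) = \<phi> r * \<phi> s"
    and hom_1: "\<phi> 1 = 1"
    and hom_const: "\<phi> (ratfun_const c) = ratfun_const c"
begin

lemma hom_0: "\<phi> 0 = 0"
  using hom_add[of 0 0] by (metis add_0_right add_left_cancel)

lemma hom_sum: "\<phi> (\<Sum>i\<in>A. r i) = (\<Sum>i\<in>A. \<phi> (r i))"
  by (induction A rule: infinite_finite_induct) (auto simp: hom_0 hom_add)

lemma hom_power: "\<phi> (r ^ k) = \<phi> r ^ k"
  by (induction k) (auto simp: hom_1 hom_mult)

lemma hom_prod: "\<phi> (\<Prod>i\<in>A. r i) = (\<Prod>i\<in>A. \<phi> (r i))"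
  by (induction A rule: infinite_finite_induct) (auto simp: hom_1 hom_mult)

text \<open>On polynomials, \<phi> is substitution of the images of the variables.\<close>

lemma hom_Fract_1:
  "\<phi> (Fract p 1) = (\<Sum>m\<in>Poly_Mapping.keys p. ratfun_const (Poly_Mapping.lookup p m) *
    (\<Prod>i\<in>UNIV. \<phi> (Fract (mpoly_var i) 1) ^ Poly_Mapping.lookup m i))"
  by (subst Fract_mpoly_expand) (simp add: hom_sum hom_mult hom_const hom_prod hom_power)

lemma hom_Fract:
  assumes "q \<noteq> 0" and "\<phi> (Fract q 1) \<noteq> 0"
  shows "\<phi> (Fract p q) = \<phi> (Fract p 1) * inverse (\<phi> (Fract q 1))"
proof -
  have "Fract p q * Fract q 1 = Fract p 1"
    using assms(1) by (simp add: eq_fract)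
  then have "\<phi> (Fract p q) * \<phi> (Fract q 1) = \<phi> (Fract p 1)"
    by (metis hom_mult)
  then show ?thesis using assms(2) by (simp add: field_simps)
qed

lemma eq_id_if_fixes_vars:
  assumes "\<And>i. \<phi> (Fract (mpoly_var i) 1) = Fract (mpoly_var i) 1"
  shows "\<phi> = id"
proof
  fix r :: "'n real_ratfun"
  obtain p q where r: "r = Fract p q" "q \<noteq> 0"
    by (cases r)
  \<comment> \<open>With the variables fixed, the expansion of the image of \<open>s\<close> is the
    expansion of \<open>s\<close> itself.\<close>
  have fix_poly: "\<phi> (Fract s 1) = Fract s 1" for s
    using hom_Fract_1[of s] by (simp only: assms flip: Fract_mpoly_expand)
  have "Fract q 1 \<noteq> 0"
    using r(2) by (simp add: Zero_fract_def eq_fract)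
  then show "\<phi> r = id r"
    using r by (simp add: hom_Fract fix_poly)
qed

section \<open>Pointwise values of images under \<phi>\<close>

lemma takes_value_hom_Fract_1:
  assumes "\<And>i. takes_value (\<phi> (Fract (mpoly_var i) 1)) x (y $ i)"
  shows "takes_value (\<phi> (Fract p 1)) x (mpoly_eval p y)"
  unfolding mpoly_eval_def
  by (subst hom_Fract_1)
    (intro takes_value_sum takes_value_mult takes_value_const takes_value_prod takes_value_power assms)

text \<open>The image of \<open>r\<close> is \<open>r\<close> composed with the images of the
  variables. Its value at \<open>x\<close> exists because the denominator of \<open>r\<close>
  vanishes nowhere, in particular not at \<open>y\<close>.\<close>

lemma takes_value_hom_represents:
  assumes "\<And>i. takes_value (\<phi> (Fract (mpoly_var i) 1)) x (y $ i)" and "represents r g"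
  shows "takes_value (\<phi> r) x (g y)"
proof -
  obtain p q where r: "r = Fract p q" and q: "\<And>z. mpoly_eval q z \<noteq> 0"
      and g: "g y = mpoly_eval p y / mpoly_eval q y"
    using assms(2) unfolding represents_def by blast
  have P: "takes_value (\<phi> (Fract p 1)) x (mpoly_eval p y)"
    and Q: "takes_value (\<phi> (Fract q 1)) x (mpoly_eval q y)"
    by (rule takes_value_hom_Fract_1, rule assms(1))+
  have "q \<noteq> 0" using q[of 0] by auto
  \<comment> \<open>The image of \<open>q\<close> takes the nonzero value
    \<open>mpoly_eval q y\<close> at \<open>x\<close>, whereas the zero element takes only the value
    0.\<close>
  moreover have "\<phi> (Fract q 1) \<noteq> 0"
    using takes_value_unique[OF Q] takes_value_0[of x] q[of y] by metis
  ultimately show ?thesis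
    using takes_value_mult[OF P takes_value_inverse[OF Q q]] g r
    by (simp add: hom_Fract divide_inverse)
qed

lemma eq_id_if_fixes_injective_map:
  fixes F :: "real ^ 'n::{finite,linorder} \<Rightarrow> real ^ 'n::{finite,linorder}"
  assumes "inj F" and F: "everywhere_defined_rational_map F"
    and fixes_F: "\<And>r i. represents r (\<lambda>x. F x $ i) \<Longrightarrow> \<phi> r = r"
  shows "\<phi> = id"
proof (rule eq_id_if_fixes_vars)
  fix k
  have "\<exists>a b. \<phi> (Fract (mpoly_var i) 1) = Fract a b \<and> b \<noteq> 0" for i
    by (cases "\<phi> (Fract (mpoly_var i) 1)") auto
  then obtain a b where ab: "\<And>i. \<phi> (Fract (mpoly_var i) 1) = Fract (a i) (b i)"
      and b: "\<And>i. b i \<noteq> 0"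
    by metis
  \<comment> \<open>The desired equality with denominators cleared. It suffices to test it where the
    product of all \<open>b i\<close> is nonzero, so that all images of variables have values
    simultaneously.\<close>
  have "a k = mpoly_var k * b k"
  proof (rule mpoly_eqI_generic)
    show "(\<Prod>i\<in>UNIV. b i) \<noteq> 0" using b by simp
    fix x
    assume "mpoly_eval (\<Prod>i\<in>UNIV. b i) x \<noteq> 0"
    then have bx: "mpoly_eval (b i) x \<noteq> 0" for i by simp
    define y where "y = (\<chi> i. mpoly_eval (a i) x / mpoly_eval (b i) x)"
    have y: "takes_value (\<phi> (Fract (mpoly_var i) 1)) x (y $ i)" for i
      unfolding ab y_def using takes_valueI[OF bx] by simp
    have "F y $ j = F x $ j" for j
    proof -
      obtain r where r: "represents r (\<lambda>x. F x $ j)"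
        using F unfolding everywhere_defined_rational_map_def by blast
      \<comment> \<open>By substitution the image of \<open>r\<close> takes the value
        \<open>F y $ j\<close> at \<open>x\<close>, and this image is \<open>r\<close> itself, whose
        value there is \<open>F x $ j\<close>.\<close>
      then have "takes_value r x (F y $ j)"
        using takes_value_hom_represents[OF y r] fixes_F[OF r] by simp
      then show ?thesis
        using takes_value_unique takes_value_represents[OF r] by blast
    qed
    then have "F y = F x" by (simp add: vec_eq_iff)
    then have "y = x" by (rule injD[OF \<open>inj F\<close>])
    then have "y $ k = x $ k" by simp
    then show "mpoly_eval (a k) x = mpoly_eval (mpoly_var k * b k) x"
      using bx[of k] by (simp add: y_def field_simps)
  qed
  then show "\<phi> (Fract (mpoly_var k) 1) = Fract (mpoly_var k) 1"
    unfolding ab using b[of k] by (simp add: eq_fract)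
qed

end

theorem proposition36:
  fixes F :: "real ^ 'n::{finite,linorder} \<Rightarrow> real ^ 'n::{finite,linorder}"
  assumes "everywhere_defined_rational_map F"
    and "\<forall>x. det (jacobian F (at x)) \<noteq> 0"
    and "bij F"
  shows "{\<phi> \<in> ring_iso ratfun_field ratfun_field. \<forall>r\<in>component_field F. \<phi> r = r} = {id}"
proof (intro equalityI subsetI)
  fix \<phi> :: "'n real_ratfun \<Rightarrow> 'n real_ratfun"
  assume "\<phi> \<in> {\<phi> \<in> ring_iso ratfun_field ratfun_field. \<forall>r\<in>component_field F. \<phi> r = r}"
  then have iso: "\<phi> \<in> ring_iso ratfun_field ratfun_field"
    and fixed: "\<And>r. r \<in> component_field F \<Longrightarrow> \<phi> r = r"
    by auto
  \<comment> \<open>Real constants are among the generators of \<open>component_field F\<close>,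
    hence fixed; the other laws are those of a ring isomorphism after unfolding
    \<open>ratfun_field\<close>.\<close>
  interpret ratfun_endomorphism \<phi>
  proof
    show "\<phi> (ratfun_const c) = ratfun_const c" for c
      by (rule fixed) (auto simp: component_field_def intro: generate_field.incl)
  qed (use ring_iso_memE[OF iso] in \<open>auto simp: ratfun_field_def ring_of_type_algebra_def\<close>)
  have "\<phi> = id"
  proof (rule eq_id_if_fixes_injective_map)
    show "inj F" using assms(3) by (rule bij_is_inj)
    show "\<phi> r = r" if "represents r (\<lambda>x. F x $ i)" for r i
      by (rule fixed) (use that in \<open>auto simp: component_field_def intro: generate_field.incl\<close>)
  qed (rule assms(1))
  then show "\<phi> \<in> {id}" by simp
next
  fix \<phi> :: "'n real_ratfun \<Rightarrow> 'n real_ratfun"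
  assume "\<phi> \<in> {id}"
  moreover have "id \<in> ring_iso ratfun_field ratfun_field"
    by (rule ring_iso_memI) auto
  ultimately show "\<phi> \<in> {\<phi> \<in> ring_iso ratfun_field ratfun_field. \<forall>r\<in>component_field F. \<phi> r = r}"
    by simp
qed

end
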